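(* For interval selection with unit weights and revocable acceptances, for every instance, every arrival order, every fixed optimal solution used as reference, and every assignment of binary predictions with total error $\eta$ (measured with respect to that optimal solution), Algorithm Revoke-Unit outputs a set of pairwise disjoint intervals of total weight $ALG \geq OPT - \eta$.
   Context: Interval selection: an instance is a finite nonempty set $\mathcal{I}$ of intervals $[s_i,f_i)$ on the real line, $s_i<f_i$, arriving one at a time in an arbitrary (adversarial) order. Two intervals conflict if they intersect; a conflict is either a proper inclusion (one interval is properly contained in the other) or a partial conflict (they intersect and neither contains the other). Each interval $I$ has a weight $w(I)$; unit weights means $w(I)=1$ for all $I$. The goal is to output a set of pairwise disjoint intervals of maximum total weight. $OPT$ denotes the maximum total weight of a set of pairwise disjoint intervals of the instance, and $ALG$ the total weight of the algorithm's final solution. Revocable acceptances: a newly arrived interval may be accepted by discarding all conflicting intervals in the current solution; rejected or discarded intervals can never be used again. Predictions: each interval $I$ arrives together with a bit $Prd(I)\in\{0,1\}$; $Prd(I)=1$ means $I$ is predicted to belong to a fixed optimal solution $O$, and $Prd(I)=0$ means it is predicted not to belong to $O$. The prediction of $I$ is accurate if ($Prd(I)=1 \iff I\in O$). Predictions may be arbitrary. Error (with respect to $O$, which may be any optimal solution): $\eta(I)=0$ if the prediction of $I$ is accurate; $\eta(I)=w(I)$ if $I\in O$ and $Prd(I)=0$; $\eta(I)=\sum_{J\in\mathcal{C}}w(J)-w(I)$ if $I\notin O$ and $Prd(I)=1$, where $\mathcal{C}$ is the set of intervals of $O$ that conflict with $I$. The total error is $\eta=\sum_{I\in\mathcal{I}}\eta(I)$.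 Algorithm Revoke-Unit: maintain a solution set $S$ and a set $M$ of marked intervals, both initially empty. On the arrival of $I$, let $I_s$ be the set of intervals of $S$ conflicting with $I$. (1) If $I_s=\emptyset$, add $I$ to $S$. If $I_s=\{I'\}$ and $I\subset I'$ (proper inclusion), replace $I'$ by $I$ in $S$, and if $I'\in M$ also add $I$ to $M$. (2) Otherwise, if $I$ is only involved in partial conflicts with the intervals of $I_s$, and $Prd(I)=1$, and $I_s\cap M=\emptyset$, then set $S\gets (S\cup\{I\})\setminus I_s$ and add $I$ to $M$. (3) Otherwise reject $I$. *)

theory Defs imports Complex_Main "HOL-Library.Disjoint_Sets" begin

text \<open>An interval is represented by the set of its points. Since \<open>s < f\<close>, the endpoints of
  \<open>{s..<f}\<close> are determined by that set, so equality, intersection and inclusion of intervals are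
  the set-theoretic ones.\<close>

type_synonym interval = "real set"

definition is_instance :: "interval set \<Rightarrow> bool" where
  "is_instance \<I> \<longleftrightarrow>
     finite \<I> \<and> \<I> \<noteq> {} \<and> (\<forall>I\<in>\<I>. \<exists>s f. s < f \<and> I = {s..<f})"

definition conflict :: "interval \<Rightarrow> interval \<Rightarrow> bool" where
  "conflict I J \<longleftrightarrow> I \<inter> J \<noteq> {}"

definition partial_conflict :: "interval \<Rightarrow> interval \<Rightarrow> bool" where
  "partial_conflict I J \<longleftrightarrow> conflict I J \<and> \<not> I \<subseteq> J \<and> \<not> J \<subseteq> I"

definition conflicts_in :: "interval set \<Rightarrow> interval \<Rightarrow> interval set" where
  "conflicts_in S I = {J \<in> S. conflict I J}"

definition weight :: "(interval \<Rightarrow> real) \<Rightarrow> interval set \<Rightarrow> real" where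
  "weight w S = (\<Sum>I\<in>S. w I)"

definition feasible :: "interval set \<Rightarrow> interval set \<Rightarrow> bool" where
  "feasible \<I> S \<longleftrightarrow> S \<subseteq> \<I> \<and> disjoint S"

definition OPT :: "(interval \<Rightarrow> real) \<Rightarrow> interval set \<Rightarrow> real" where
  "OPT w \<I> = Max (weight w ` {S. feasible \<I> S})"

definition optimal :: "(interval \<Rightarrow> real) \<Rightarrow> interval set \<Rightarrow> interval set \<Rightarrow> bool" where
  "optimal w \<I> Q \<longleftrightarrow> feasible \<I> Q \<and> weight w Q = OPT w \<I>"

text \<open>Prediction errors are relative to a reference solution \<open>Q\<close>; \<open>Prd I = True\<close> predicts that
  \<open>I\<close> belongs to \<open>Q\<close>.\<close>

definition error ::
  "(interval \<Rightarrow> real) \<Rightarrow> interval set \<Rightarrow> (interval \<Rightarrow> bool) \<Rightarrow> interval \<Rightarrow> real" where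
  "error w Q Prd I =
     (if Prd I \<longleftrightarrow> I \<in> Q then 0
      else if I \<in> Q then w I
      else weight w (conflicts_in Q I) - w I)"

definition total_error ::
  "(interval \<Rightarrow> real) \<Rightarrow> interval set \<Rightarrow> interval set \<Rightarrow> (interval \<Rightarrow> bool) \<Rightarrow> real" where
  "total_error w \<I> Q Prd = (\<Sum>I\<in>\<I>. error w Q Prd I)"

text \<open>One arrival: an interval with its prediction bit, processed in state \<open>(S, M)\<close> (current
  solution, marked intervals). In the second branch \<open>Is\<close> is the singleton \<open>{I'}\<close>, so
  \<open>Is \<subseteq> M\<close> says that \<open>I'\<close> is marked.\<close>

fun revoke_unit_step ::
  "interval \<times> bool \<Rightarrow> interval set \<times> interval set \<Rightarrow> interval set \<times> interval set" where
  "revoke_unit_step (I, p) (S, M) =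
     (let Is = conflicts_in S I in
      if Is = {} then (S \<union> {I}, M)
      else if \<exists>I'. Is = {I'} \<and> I \<subset> I' then
        ((S \<union> {I}) - Is, if Is \<subseteq> M then M \<union> {I} else M)
      else if (\<forall>J\<in>Is. partial_conflict I J) \<and> p \<and> Is \<inter> M = {} then
        ((S \<union> {I}) - Is, M \<union> {I})
      else (S, M))"

definition revoke_unit :: "(interval \<times> bool) list \<Rightarrow> interval set" where
  "revoke_unit arrivals = fst (fold revoke_unit_step arrivals ({}, {}))"

end

theory Submission imports Defs begin

text \<open>Call the interval that enters \<open>M\<close> through rule (2) the origin of all marked intervals that
  later replace it by shrinking. Marked intervals are never lost, so distinct marked intervals of
  the solution have distinct origins. Every interval \<open>X\<close> of the optimum \<open>Q\<close> that is predicted 1 and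
  has arrived is charged to the current solution: it contains an unmarked interval or it meets the
  origin of a marked one. An unmarked interval is charged at most once, and a marked one with
  origin \<open>K\<close> at most \<open>1 + \<eta>(K)\<close> times. The intervals of \<open>Q\<close> predicted 0 pay for themselves.\<close>

definition charging ::
  "interval set \<Rightarrow> (interval \<Rightarrow> bool) \<Rightarrow> interval set \<Rightarrow> interval set \<Rightarrow> interval set \<Rightarrow>
    (interval \<Rightarrow> interval) \<Rightarrow> bool" where
  "charging Q Prd A S M g \<longleftrightarrow>
     disjoint S \<and> S \<subseteq> A \<and> M \<subseteq> A \<and> {} \<notin> A \<and> inj_on g (S \<inter> M) \<and>
     (\<forall>J\<in>S \<inter> M. J \<subseteq> g J \<and> g J \<in> A \<and> Prd (g J)) \<and>
     (\<forall>X\<in>Q \<inter> A. Prd X \<longrightarrow> (\<exists>J\<in>S - M. J \<subseteq> X) \<or> (\<exists>J\<in>S \<inter> M. conflict (g J) X))"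

lemma chargingI:
  assumes "disjoint S" "S \<subseteq> A" "M \<subseteq> A" "{} \<notin> A" "inj_on g (S \<inter> M)"
    and "\<And>J. J \<in> S \<Longrightarrow> J \<in> M \<Longrightarrow> J \<subseteq> g J \<and> g J \<in> A \<and> Prd (g J)"
    and "\<And>X. X \<in> Q \<Longrightarrow> X \<in> A \<Longrightarrow> Prd X \<Longrightarrow>
      (\<exists>J\<in>S - M. J \<subseteq> X) \<or> (\<exists>J\<in>S \<inter> M. conflict (g J) X)"
  shows "charging Q Prd A S M g"
  using assms unfolding charging_def by blast

section \<open>Survival of the charging through the arrivals\<close>

lemma disjoint_insert_conflict:
  assumes "disjoint S" "T \<subseteq> S" "\<And>J. J \<in> T \<Longrightarrow> \<not> conflict I J"
  shows "disjoint (insert I T)"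
  using assms unfolding disjoint_def conflict_def by blast

text \<open>An arrival disturbs the charging only by discarding an interval that carries charges, or
  by being itself a member of \<open>Q\<close> that is predicted 1. In the first case the charges
  pass to \<open>I\<close>; in the second, the branch taken shows what \<open>I\<close> is charged
  to.\<close>

lemma charging_step:
  assumes inv: "charging Q Prd A S M g" and new: "I \<notin> A" and ne: "I \<noteq> {}"
    and step: "revoke_unit_step (I, Prd I) (S, M) = (S', M')"
  shows "\<exists>g'. charging Q Prd (insert I A) S' M' g'"
proof -
  have disj: "disjoint S" and SA: "S \<subseteq> A" and MA: "M \<subseteq> A" and ne_A: "{} \<notin> A"
    and inj: "inj_on g (S \<inter> M)"
    and orig: "\<And>J. J \<in> S \<Longrightarrow> J \<in> M \<Longrightarrow> J \<subseteq> g J \<and> g J \<in> A \<and> Prd (g J)"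
    and charged: "\<And>X. X \<in> Q \<Longrightarrow> X \<in> A \<Longrightarrow> Prd X \<Longrightarrow>
      (\<exists>J\<in>S - M. J \<subseteq> X) \<or> (\<exists>J\<in>S \<inter> M. conflict (g J) X)"
    using inv unfolding charging_def by auto
  have IS: "I \<notin> S" and IM: "I \<notin> M" using new SA MA by auto
  have ne_A': "{} \<notin> insert I A" using ne ne_A by auto
  define Is where "Is = conflicts_in S I"
  have IsS: "Is \<subseteq> S" unfolding Is_def conflicts_in_def by auto
  have free: "\<not> conflict I J" if "J \<in> S - Is" for J
    using that unfolding Is_def conflicts_in_def by auto
  have disj': "disjoint (insert I (S - Is))"
    by (rule disjoint_insert_conflict[OF disj _ free]) auto
  have ins: "(S \<union> {I}) - Is = insert I (S - Is)" using IS IsS by auto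
  consider (free) "Is = {}" "S' = insert I S" "M' = M"
    | (shrink) I' where "Is = {I'}" "I \<subset> I'" "S' = insert I (S - {I'})"
        "M' = (if I' \<in> M then M \<union> {I} else M)"
    | (mark) "Prd I" "Is \<inter> M = {}" "S' = insert I (S - Is)" "M' = insert I M"
    | (reject) "Is \<noteq> {}" "\<nexists>I'. Is = {I'} \<and> I \<subset> I'"
        "(\<forall>J\<in>Is. partial_conflict I J) \<and> Prd I \<longrightarrow> Is \<inter> M \<noteq> {}" "S' = S" "M' = M"
  proof (cases "Is = {}")
    case True
    then show ?thesis using step that(1) by (simp add: Is_def)
  next
    case nonempty: False
    have step': "(if \<exists>I'. Is = {I'} \<and> I \<subset> I' then
        (insert I (S - Is), if Is \<subseteq> M then M \<union> {I} else M)
      else if (\<forall>J\<in>Is. partial_conflict I J) \<and> Prd I \<and> Is \<inter> M = {} then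
        (insert I (S - Is), M \<union> {I})
      else (S, M)) = (S', M')"
      using step nonempty unfolding revoke_unit_step.simps Let_def Is_def[symmetric] ins
      by (simp only: if_False)
    show ?thesis
    proof (cases "\<exists>I'. Is = {I'} \<and> I \<subset> I'")
      case True
      then obtain I' where "Is = {I'}" "I \<subset> I'" by blast
      then show ?thesis using step' that(2)[of I'] by simp
    next
      case not_shrink: False
      show ?thesis
      proof (cases "(\<forall>J\<in>Is. partial_conflict I J) \<and> Prd I \<and> Is \<inter> M = {}")
        case True
        then show ?thesis using step' not_shrink that(3) by (simp only: if_True if_False) simp
      next
        case False
        then have "S' = S" "M' = M" using step' not_shrink by (simp only: if_False, simp)+
        then show ?thesis using that(4) nonempty not_shrink False by blast
      qed
    qed
  qed
  then show ?thesis
  proof cases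
    case free
    have eq: "S' \<inter> M' = S \<inter> M" using free IM by auto
    have "charging Q Prd (insert I A) S' M' g"
    proof (rule chargingI)
      show "disjoint S'" using disj' free by simp
      show "(\<exists>J\<in>S' - M'. J \<subseteq> X) \<or> (\<exists>J\<in>S' \<inter> M'. conflict (g J) X)"
        if "X \<in> Q" "X \<in> insert I A" "Prd X" for X
      proof (cases "X = I")
        \<comment> \<open>\<open>I\<close> enters unmarked and is charged to itself.\<close>
        case True then show ?thesis using free IM by auto
      next
        case False then show ?thesis using charged[of X] that free IM eq by auto
      qed
    qed (use SA MA ne_A' inj eq orig free IM in auto)
    then show ?thesis by blast
  next
    case shrink
    have I': "I' \<in> S" "conflict I I'" "I' \<in> A" using shrink(1) SA
      unfolding Is_def conflicts_in_def by auto
    \<comment> \<open>The replacement inherits the origin of \<open>I'\<close>, so a chain of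
      replacements keeps pointing at the interval that started it.\<close>
    define h where "h = g(I := g I')"
    have h: "h I = g I'" "\<And>J. J \<in> S \<Longrightarrow> h J = g J" using IS unfolding h_def by auto
    have mem: "J \<in> S' \<inter> M' \<longleftrightarrow> (J \<in> S \<inter> M \<and> J \<noteq> I') \<or> (J = I \<and> I' \<in> M)" for J
      using shrink IM IS I' by auto
    have inj': "inj_on h (S' \<inter> M')"
    proof (rule inj_onI)
      \<comment> \<open>Each marked interval of the new solution carries the origin of one marked
        interval of the old solution: itself, or \<open>I'\<close> in the case of \<open>I\<close>.
        Distinct ones go back to distinct ones, so injectivity carries over from
        \<open>g\<close>.\<close>
      have prior: "(L \<in> S \<inter> M \<and> h L = g L \<and> L \<noteq> I') \<or> (L = I \<and> I' \<in> S \<inter> M \<and> h L = g I')"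
        if "L \<in> S' \<inter> M'" for L
        using that I' h mem[of L] by blast
      fix J L assume "J \<in> S' \<inter> M'" "L \<in> S' \<inter> M'" "h J = h L"
      then show "J = L" using prior[of J] prior[of L] inj_onD[OF inj] by metis
    qed
    have "charging Q Prd (insert I A) S' M' h"
    proof (rule chargingI)
      show "disjoint S'" using disj' shrink by simp
      show "J \<subseteq> h J \<and> h J \<in> insert I A \<and> Prd (h J)" if "J \<in> S'" "J \<in> M'" for J
      proof -
        have "(J \<in> S \<inter> M \<and> J \<noteq> I') \<or> (J = I \<and> I' \<in> M)" using that mem by blast
        then show ?thesis
        proof (elim disjE conjE)
          assume "J \<in> S \<inter> M"
          then show ?thesis using orig[of J] h(2) by simp
        next
          assume "J = I" "I' \<in> M"
          then show ?thesis using orig[OF I'(1)] h(1) shrink(2) by auto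
        qed
      qed
      show "(\<exists>J\<in>S' - M'. J \<subseteq> X) \<or> (\<exists>J\<in>S' \<inter> M'. conflict (h J) X)"
        if "X \<in> Q" "X \<in> insert I A" "Prd X" for X
      proof (cases "X = I")
        case True
        show ?thesis
        proof (cases "I' \<in> M")
          case True
          \<comment> \<open>\<open>I\<close> lies in \<open>I'\<close>, which lies in its origin;
            being nonempty, \<open>I\<close> meets that origin.\<close>
          have "conflict (h I) X"
            using orig[OF I'(1) True] h(1) shrink(2) ne \<open>X = I\<close> unfolding conflict_def by auto
          then show ?thesis using mem[of I] True by blast
        next
          case False then show ?thesis using shrink IM \<open>X = I\<close> by auto
        qed
      next
        case False
        then have "(\<exists>J\<in>S - M. J \<subseteq> X) \<or> (\<exists>J\<in>S \<inter> M. conflict (g J) X)"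
          using charged that by auto
        \<comment> \<open>Charges to \<open>I'\<close> move to \<open>I\<close>: if
          \<open>I'\<close> is unmarked, \<open>X\<close> contains \<open>I'\<close> and hence the
          smaller \<open>I\<close>; if it is marked, the origin is unchanged.\<close>
        then show ?thesis
        proof (elim disjE bexE)
          fix J assume J: "J \<in> S - M" "J \<subseteq> X"
          show ?thesis
          proof (cases "J = I'")
            case True
            then have "I \<in> S' - M'" "I \<subseteq> X" using J shrink IM by auto
            then show ?thesis by blast
          next
            case False
            then have "J \<in> S' - M'" using J shrink IS by auto
            then show ?thesis using J by blast
          qed
        next
          fix J assume J: "J \<in> S \<inter> M" "conflict (g J) X"
          show ?thesis
          proof (cases "J = I'")
            case True
            then have "I \<in> S' \<inter> M'" "conflict (h I) X" using J h mem[of I] by simp_all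
            then show ?thesis by blast
          next
            case False
            then have "J \<in> S' \<inter> M'" "conflict (h J) X" using J h mem[of J] by simp_all
            then show ?thesis by blast
          qed
        qed
      qed
    qed (use SA MA ne_A' inj' shrink in auto)
    then show ?thesis by blast
  next
    case mark
    \<comment> \<open>An interval marked by rule (2) is its own origin.\<close>
    define h where "h = g(I := I)"
    have h: "h I = I" "\<And>J. J \<in> S \<Longrightarrow> h J = g J" using IS unfolding h_def by auto
    \<comment> \<open>No marked interval is discarded, because \<open>Is\<close> avoids
      \<open>M\<close>; all charges through old origins therefore stand.\<close>
    have eq: "S' \<inter> M' = insert I (S \<inter> M)" using mark IM IS by auto
    have "inj_on h (S \<inter> M)" using inj h(2) by (auto simp: inj_on_def)
    \<comment> \<open>Old origins are past arrivals, whereas \<open>I\<close> is fresh.\<close>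
    moreover have "I \<notin> h ` (S \<inter> M)" using orig new h(2) by auto
    ultimately have inj': "inj_on h (S' \<inter> M')" unfolding eq inj_on_insert h(1) by blast
    have "charging Q Prd (insert I A) S' M' h"
    proof (rule chargingI)
      show "disjoint S'" using disj' mark by simp
      show "J \<subseteq> h J \<and> h J \<in> insert I A \<and> Prd (h J)" if "J \<in> S'" "J \<in> M'" for J
      proof (cases "J = I")
        case True then show ?thesis using h(1) mark(1) by simp
      next
        case False
        then have "J \<in> S" "J \<in> M" using that eq by blast+
        then show ?thesis using orig[of J] h(2) by simp
      qed
      show "(\<exists>J\<in>S' - M'. J \<subseteq> X) \<or> (\<exists>J\<in>S' \<inter> M'. conflict (h J) X)"
        if "X \<in> Q" "X \<in> insert I A" "Prd X" for X
      proof (cases "X = I")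
        case True
        then show ?thesis using eq h(1) ne unfolding conflict_def by auto
      next
        case False
        then have "(\<exists>J\<in>S - M. J \<subseteq> X) \<or> (\<exists>J\<in>S \<inter> M. conflict (g J) X)"
          using charged that by auto
        then show ?thesis
        proof (elim disjE bexE)
          fix J assume J: "J \<in> S - M" "J \<subseteq> X"
          \<comment> \<open>If \<open>J\<close> is discarded, it meets \<open>I\<close> and lies in
            \<open>X\<close>, so \<open>X\<close> meets the new origin \<open>I\<close> and its
            charge moves there.\<close>
          show ?thesis
          proof (cases "J \<in> Is")
            case True
            then have "conflict (h I) X"
              using J(2) h(1) unfolding Is_def conflicts_in_def conflict_def by auto
            then show ?thesis using eq by blast
          next
            case False
            then have "J \<in> S' - M'" using J mark IS by auto
            then show ?thesis using J by blast
          qed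
        next
          fix J assume "J \<in> S \<inter> M" "conflict (g J) X"
          then show ?thesis using eq h(2) by auto
        qed
      qed
    qed (use SA MA ne_A' inj' mark in auto)
    then show ?thesis by blast
  next
    case reject
    have "charging Q Prd (insert I A) S M g"
    proof (rule chargingI)
      show "(\<exists>J\<in>S - M. J \<subseteq> X) \<or> (\<exists>J\<in>S \<inter> M. conflict (g J) X)"
        if "X \<in> Q" "X \<in> insert I A" "Prd X" for X
      proof (cases "X = I")
        case XI: True
        show ?thesis
        \<comment> \<open>Only the rejected \<open>I\<close> itself lacks a charge. As it is
          predicted 1, rule (2) failed either because a conflict is marked or because some conflict
          is an inclusion.\<close>
        proof (cases "Is \<inter> M = {}")
          case True
          then obtain J where J: "J \<in> Is" "\<not> partial_conflict I J"
            using reject(3) \<open>Prd X\<close> XI by blast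
          have JS: "J \<in> S" "conflict I J" using J(1) unfolding Is_def conflicts_in_def by auto
          \<comment> \<open>If \<open>J\<close> contained \<open>I\<close>, every other conflict of
            \<open>I\<close> would meet \<open>J\<close> as well. Disjointness of \<open>S\<close>
            would leave \<open>J\<close> as the only conflict, and rule (1) would have replaced it.
            So the inclusion goes the other way, and \<open>I\<close> contains the unmarked
            \<open>J\<close>.\<close>
          have "\<not> I \<subseteq> J"
          proof
            assume "I \<subseteq> J"
            then have "I \<subset> J" using JS(1) IS by auto
            moreover have "L = J" if "L \<in> Is" for L
            proof (rule ccontr)
              assume "L \<noteq> J"
              then have "L \<inter> J = {}"
                using disj that IsS JS(1) unfolding disjoint_def by blast
              then show False
                using that \<open>I \<subseteq> J\<close> unfolding Is_def conflicts_in_def conflict_def by auto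
            qed
            ultimately show False using reject(2) J(1) by blast
          qed
          then have "J \<subseteq> X" using J(2) JS(2) XI unfolding partial_conflict_def by auto
          then show ?thesis using JS(1) J(1) True by auto
        next
          case False
          then obtain J where J: "J \<in> Is" "J \<in> M" by auto
          then have "J \<in> S" "conflict I J" unfolding Is_def conflicts_in_def by auto
          \<comment> \<open>The origin of \<open>J\<close> contains \<open>J\<close>, so it meets
            whatever \<open>J\<close> meets.\<close>
          then have "conflict (g J) X"
            using orig[of J] J(2) XI unfolding conflict_def by auto
          then show ?thesis using \<open>J \<in> S\<close> J(2) by auto
        qed
      next
        case False then show ?thesis using charged[of X] that by auto
      qed
    qed (use disj SA MA ne_A' inj orig in auto)
    then show ?thesis using reject by auto
  qed
qed

lemma charging_fold:
  assumes "distinct order" "{} \<notin> set order"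
  shows "\<exists>S M g. fold revoke_unit_step (map (\<lambda>I. (I, Prd I)) order) ({}, {}) = (S, M) \<and>
    charging Q Prd (set order) S M g"
  using assms
proof (induction order rule: rev_induct)
  case Nil
  have "charging Q Prd {} {} {} id" by (rule chargingI) auto
  then show ?case by auto
next
  case (snoc I xs)
  then obtain S M g
    where SM: "fold revoke_unit_step (map (\<lambda>I. (I, Prd I)) xs) ({}, {}) = (S, M)"
      and ch: "charging Q Prd (set xs) S M g" by auto
  obtain S' M' where step: "revoke_unit_step (I, Prd I) (S, M) = (S', M')"
    by (cases "revoke_unit_step (I, Prd I) (S, M)")
  \<comment> \<open>Distinctness of the order makes each arrival fresh, as a new origin must
    be.\<close>
  have "I \<notin> set xs" "I \<noteq> {}" using snoc.prems by auto
  from charging_step[OF ch this step] obtain g' where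
    "charging Q Prd (insert I (set xs)) S' M' g'" by blast
  then show ?case using SM step by auto
qed

section \<open>Unit weights, optimality and the size of the errors\<close>

lemma weight_unit:
  assumes "\<forall>I\<in>\<I>. w I = 1" "S \<subseteq> \<I>"
  shows "weight w S = real (card S)"
proof -
  have "(\<Sum>I\<in>S. w I) = (\<Sum>I\<in>S. 1)" using assms by (intro sum.cong) auto
  then show ?thesis unfolding weight_def by simp
qed

lemma weight_le_OPT:
  assumes "finite \<I>" "feasible \<I> S"
  shows "weight w S \<le> OPT w \<I>"
proof -
  have "finite {S. feasible \<I> S}"
    by (rule finite_subset[of _ "Pow \<I>"]) (use assms(1) in \<open>auto simp: feasible_def\<close>)
  then show ?thesis unfolding OPT_def using assms(2) by (intro Max_ge) auto
qed

text \<open>Otherwise \<open>I\<close> could be added to \<open>Q\<close>, giving a feasible set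
  heavier than the optimum.\<close>

lemma optimal_conflicts_nonempty:
  assumes "finite \<I>" "optimal w \<I> Q" "I \<in> \<I>" "I \<notin> Q" "w I > 0"
  shows "conflicts_in Q I \<noteq> {}"
proof
  assume "conflicts_in Q I = {}"
  then have free: "\<And>J. J \<in> Q \<Longrightarrow> \<not> conflict I J" unfolding conflicts_in_def by auto
  have Q: "Q \<subseteq> \<I>" "disjoint Q" "weight w Q = OPT w \<I>"
    using assms(2) unfolding optimal_def feasible_def by auto
  have "disjoint (insert I Q)" by (rule disjoint_insert_conflict[OF Q(2) order_refl free])
  then have "weight w (insert I Q) \<le> OPT w \<I>"
    using weight_le_OPT[OF assms(1)] Q(1) assms(3) by (auto simp: feasible_def)
  moreover have "weight w (insert I Q) = w I + weight w Q"
    using assms(1,4) Q(1) finite_subset unfolding weight_def by (subst sum.insert) auto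
  ultimately show False using Q(3) assms(5) by simp
qed

text \<open>Only a wrong prediction 1 could have negative error. With unit weights its error is the
  number of conflicts with \<open>Q\<close> minus one, and optimality of \<open>Q\<close> provides
  at least one conflict.\<close>

lemma error_unit_nonneg:
  assumes "finite \<I>" "\<forall>I\<in>\<I>. w I = 1" "optimal w \<I> Q" "I \<in> \<I>"
  shows "error w Q Prd I \<ge> 0"
proof (cases "I \<in> Q")
  case True
  then show ?thesis using assms(2,4) by (auto simp: error_def)
next
  case False
  have Q: "Q \<subseteq> \<I>" using assms(3) unfolding optimal_def feasible_def by auto
  have sub: "conflicts_in Q I \<subseteq> \<I>" using Q unfolding conflicts_in_def by auto
  have "conflicts_in Q I \<noteq> {}"
    using optimal_conflicts_nonempty[OF assms(1,3,4) False] assms(2,4) by auto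
  then have "1 \<le> card (conflicts_in Q I)"
    using finite_subset[OF sub assms(1)] by (simp add: Suc_le_eq card_gt_0_iff)
  then show ?thesis
    using False assms(2,4) weight_unit[OF assms(2) sub] by (simp add: error_def)
qed

text \<open>This is the capacity of an origin \<open>K\<close>. Outside \<open>Q\<close> it is the
  definition of the error; inside \<open>Q\<close> the error is 0 and \<open>K\<close> can conflict
  only with itself, since \<open>Q\<close> is disjoint.\<close>

lemma card_conflicts_in_le_error:
  assumes "\<forall>I\<in>\<I>. w I = 1" "Q \<subseteq> \<I>" "disjoint Q" "K \<in> \<I>" "Prd K"
  shows "real (card (conflicts_in Q K)) \<le> 1 + error w Q Prd K"
proof (cases "K \<in> Q")
  case True
  then have "conflicts_in Q K \<subseteq> {K}"
    using assms(3) unfolding conflicts_in_def conflict_def disjoint_def by blast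
  then have "card (conflicts_in Q K) \<le> 1" using card_mono[of "{K}"] by simp
  then show ?thesis using True assms(5) by (simp add: error_def)
next
  case False
  have "conflicts_in Q K \<subseteq> \<I>" using assms(2) unfolding conflicts_in_def by auto
  from weight_unit[OF assms(1) this] show ?thesis
    using False assms(1,4,5) by (simp add: error_def)
qed

section \<open>Counting the charges\<close>

lemma card_supersets_le_1:
  assumes "disjoint Q" "J \<noteq> {}"
  shows "card {X \<in> Q. J \<subseteq> X} \<le> 1"
proof (cases "{X \<in> Q. J \<subseteq> X} = {}")
  case False
  then obtain X where X: "X \<in> Q" "J \<subseteq> X" by auto
  have "{X \<in> Q. J \<subseteq> X} \<subseteq> {X}" using assms X unfolding disjoint_def by blast
  then show ?thesis using card_mono[of "{X}"] by simp
next
  case True then show ?thesis by (simp only: card.empty)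
qed

text \<open>\<open>Q\<close> is split by prediction: the part predicted 1 is at most
  \<open>card S\<close> plus the errors of the intervals predicted 1, and the part predicted 0
  equals the errors of the intervals predicted 0. These two error sums make up \<eta>.\<close>

lemma charging_bound:
  assumes fin: "finite \<I>" and unit: "\<forall>I\<in>\<I>. w I = 1" and opt: "optimal w \<I> Q"
    and ch: "charging Q Prd \<I> S M g"
  shows "OPT w \<I> \<le> real (card S) + total_error w \<I> Q Prd"
proof -
  have Q: "Q \<subseteq> \<I>" "disjoint Q" "weight w Q = OPT w \<I>"
    using opt unfolding optimal_def feasible_def by auto
  have finQ: "finite Q" using Q(1) fin finite_subset by auto
  have SA: "S \<subseteq> \<I>" and ne: "{} \<notin> \<I>" and inj: "inj_on g (S \<inter> M)"
    and orig: "\<And>J. J \<in> S \<inter> M \<Longrightarrow> g J \<in> \<I> \<and> Prd (g J)"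
    and charged: "\<And>X. X \<in> Q \<Longrightarrow> Prd X \<Longrightarrow>
      (\<exists>J\<in>S - M. J \<subseteq> X) \<or> (\<exists>J\<in>S \<inter> M. conflict (g J) X)"
    using ch Q(1) unfolding charging_def by auto
  have finS: "finite S" using SA fin finite_subset by auto
  let ?err = "error w Q Prd"
  \<comment> \<open>The members of \<open>Q\<close> that can be charged to \<open>J\<close>. These
    sets may overlap, so the union bound is used.\<close>
  define T where "T J = (if J \<in> M then conflicts_in Q (g J) else {X \<in> Q. J \<subseteq> X})" for J
  have "{X \<in> Q. Prd X} \<subseteq> (\<Union>J\<in>S. T J)"
  proof
    fix X assume "X \<in> {X \<in> Q. Prd X}"
    then have X: "X \<in> Q" "Prd X" by auto
    from charged[OF X] show "X \<in> (\<Union>J\<in>S. T J)"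
    proof (elim disjE bexE)
      fix J assume "J \<in> S - M" "J \<subseteq> X"
      then show ?thesis using X(1) by (intro UN_I[of J]) (auto simp: T_def)
    next
      fix J assume "J \<in> S \<inter> M" "conflict (g J) X"
      then show ?thesis using X(1) by (intro UN_I[of J]) (auto simp: T_def conflicts_in_def)
    qed
  qed
  moreover have "finite (\<Union>J\<in>S. T J)"
    using finS finQ by (auto simp: T_def conflicts_in_def)
  ultimately have "card {X \<in> Q. Prd X} \<le> card (\<Union>J\<in>S. T J)" by (rule card_mono[rotated])
  also have "\<dots> \<le> (\<Sum>J\<in>S. card (T J))" by (rule card_UN_le[OF finS])
  finally have "real (card {X \<in> Q. Prd X}) \<le> (\<Sum>J\<in>S. real (card (T J)))"
    by (simp flip: of_nat_sum)
  also have "\<dots> \<le> (\<Sum>J\<in>S. 1 + (if J \<in> M then ?err (g J) else 0))"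
  proof (rule sum_mono)
    fix J assume J: "J \<in> S"
    show "real (card (T J)) \<le> 1 + (if J \<in> M then ?err (g J) else 0)"
    proof (cases "J \<in> M")
      case True
      then show ?thesis
        using card_conflicts_in_le_error[OF unit Q(1,2)] orig[of J] J by (simp add: T_def)
    next
      case False
      have "J \<noteq> {}" using J SA ne by auto
      from card_supersets_le_1[OF Q(2) this] show ?thesis using False by (simp add: T_def)
    qed
  qed
  also have "\<dots> = real (card S) + (\<Sum>J\<in>S \<inter> M. ?err (g J))"
    by (simp add: sum.distrib sum.inter_restrict[OF finS])
  \<comment> \<open>Injectivity of the origins is what keeps any error from being counted
    twice.\<close>
  also have "(\<Sum>J\<in>S \<inter> M. ?err (g J)) = (\<Sum>K\<in>g ` (S \<inter> M). ?err K)"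
    by (simp add: sum.reindex[OF inj])
  \<comment> \<open>Every origin is predicted 1, and the errors added here are nonnegative.\<close>
  also have "\<dots> \<le> (\<Sum>K\<in>{K \<in> \<I>. Prd K}. ?err K)"
    by (rule sum_mono2) (use fin orig error_unit_nonneg[OF fin unit opt] in auto)
  finally have predicted:
    "real (card {X \<in> Q. Prd X}) \<le> real (card S) + (\<Sum>K\<in>{K \<in> \<I>. Prd K}. ?err K)" by simp
  have "real (card {X \<in> Q. \<not> Prd X}) = (\<Sum>K\<in>{X \<in> Q. \<not> Prd X}. ?err K)"
    using unit Q(1) by (simp add: error_def subset_iff)
  \<comment> \<open>Outside \<open>Q\<close> a prediction 0 is accurate and contributes
    nothing.\<close>
  also have "\<dots> = (\<Sum>K\<in>{K \<in> \<I>. \<not> Prd K}. ?err K)"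
    by (rule sum.mono_neutral_left) (use fin Q(1) in \<open>auto simp: error_def\<close>)
  finally have unpredicted:
    "real (card {X \<in> Q. \<not> Prd X}) = (\<Sum>K\<in>{K \<in> \<I>. \<not> Prd K}. ?err K)" .
  have split: "card A = card {X \<in> A. Prd X} + card {X \<in> A. \<not> Prd X}" if "finite A" for A
    using that by (subst card_Un_disjoint[symmetric]) (auto intro: arg_cong[where f = card])
  have "total_error w \<I> Q Prd =
      (\<Sum>K\<in>{K \<in> \<I>. Prd K}. ?err K) + (\<Sum>K\<in>{K \<in> \<I>. \<not> Prd K}. ?err K)"
    unfolding total_error_def using fin
    by (subst sum.union_disjoint[symmetric]) (auto intro: sum.cong)
  moreover have "OPT w \<I> = real (card Q)" using Q(3) weight_unit[OF unit Q(1)] by simp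
  ultimately show ?thesis using predicted unpredicted split[OF finQ] by simp
qed

theorem theorem4p1:
  fixes \<I> Q :: "interval set" and w :: "interval \<Rightarrow> real"
    and Prd :: "interval \<Rightarrow> bool" and order :: "interval list"
  assumes "is_instance \<I>"
    and "\<forall>I\<in>\<I>. w I = 1"
    and "distinct order" and "set order = \<I>"
    and "optimal w \<I> Q"
  shows "feasible \<I> (revoke_unit (map (\<lambda>I. (I, Prd I)) order)) \<and>
    weight w (revoke_unit (map (\<lambda>I. (I, Prd I)) order)) \<ge> OPT w \<I> - total_error w \<I> Q Prd"
proof -
  have fin: "finite \<I>" and "{} \<notin> set order"
    using assms(1,4) by (fastforce simp: is_instance_def)+
  from charging_fold[OF assms(3) this(2)] obtain S M g where
    run: "fold revoke_unit_step (map (\<lambda>I. (I, Prd I)) order) ({}, {}) = (S, M)" and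
    ch: "charging Q Prd \<I> S M g" using assms(4) by blast
  have "feasible \<I> S" using ch by (simp add: charging_def feasible_def)
  moreover have "weight w S = real (card S)"
    using weight_unit[OF assms(2)] calculation by (simp add: feasible_def)
  ultimately show ?thesis
    using charging_bound[OF fin assms(2,5) ch] run by (simp add: revoke_unit_def)
qed

end
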